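(* Let $\mathcal{A}:\mathbb{R}^{k\times n}\to\mathbb{R}^m$ be linear, let $Z_0=z^0.H^0\in\mathbb{R}^{k\times n}$ have column support $S=\operatorname{supp} Z_0$, and let $i^*\in S$ and $\alpha>0$ be fixed. Suppose there exists a vector $p\in\mathbb{R}^m$ such that $V=\mathcal{A}^*p$ satisfies \begin{align*} \sum_{i\in S}\langle h_i^0,V(i)\rangle z_i^0 &\geq \|z^0\|_1,\\ \|V(i)\|_2&<1\quad\text{for all } i\in[n],\ i\neq i^*,\\ \omega\left(h_{i^*}^0,\tfrac{V(i^* )}{\|V(i^* )\|_2}\right)&\leq\alpha,\\ \|V(i^* )\|_2\cos\alpha&\leq 1. \end{align*} Then any minimizer $\hat z.\widehat H$ of the program $$\min_{Z\in\mathbb{R}^{k\times n}}\|Z\|_{1,2}\quad\text{subject to}\quad \mathcal{A}(Z)=\mathcal{A}(Z_0)$$ obeys $\omega(\hat h_{i^*},h_{i^*}^0)\leq 2\alpha$.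
   Context: Notation: $[n]=\{1,\dots,n\}$. For $Z\in\mathbb{R}^{k\times n}$, $Z(i)\in\mathbb{R}^k$ is the $i$-th column, $\operatorname{supp}Z=\{i\in[n]: Z(i)\neq 0\}$, and $\|Z\|_{1,2}=\sum_{i\in[n]}\|Z(i)\|_2$. For $z\in\mathbb{R}^n$ with nonnegative entries and $H=(h_1,\dots,h_n)$ a tuple of unit vectors $h_i\in\mathbb{S}^{k-1}\subset\mathbb{R}^k$, $z.H\in\mathbb{R}^{k\times n}$ denotes the matrix with columns $z_ih_i$. Every matrix can be written in this way; $z$ is unique, and $h_i$ is unique when $z_i\neq 0$ and arbitrary when $z_i=0$. For $Z_0=z^0.H^0$ and $\hat z.\widehat H$ the corresponding unit vectors are denoted $h_i^0$ and $\hat h_i$. The angular distance on $\mathbb{S}^{k-1}$ is $\omega(h,\hat h)=\arccos\langle h,\hat h\rangle\in[0,\pi]$. $\mathcal{A}^*:\mathbb{R}^m\to\mathbb{R}^{k\times n}$ is the adjoint of $\mathcal{A}$ with respect to the standard (Frobenius) inner products. *)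

theory Defs
  imports "HOL-Analysis.Analysis"
begin

text \<open>Matrices in \<open>\<real>\<^sup>k\<^sup>\<times>\<^sup>n\<close> have type \<open>real ^ 'n ^ 'k\<close>, so that
  the inner product of this type is the Frobenius inner product and \<open>adjoint\<close> is the adjoint
  with respect to it.\<close>

definition col_supp :: "real ^ 'n ^ 'k \<Rightarrow> 'n set"
  where "col_supp Z = {i. column i Z \<noteq> 0}"

definition norm12 :: "real ^ 'n ^ 'k \<Rightarrow> real"
  where "norm12 Z = (\<Sum>i\<in>UNIV. norm (column i Z))"

definition norm1 :: "real ^ 'n \<Rightarrow> real"
  where "norm1 z = (\<Sum>i\<in>UNIV. \<bar>z $ i\<bar>)"

text \<open>The matrix \<open>z.H\<close> with columns \<open>z\<^sub>i h\<^sub>i\<close>, written \<open>col_scale z H\<close>.\<close>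

definition col_scale :: "real ^ 'n \<Rightarrow> (real ^ 'k) ^ 'n \<Rightarrow> real ^ 'n ^ 'k"
  where "col_scale z H = (\<chi> r i. (z $ i *\<^sub>R H $ i) $ r)"

text \<open>A pair \<open>(z, H)\<close> as in the notation \<open>z.H\<close>. The vector \<open>H $ i\<close> is not
  determined by the matrix \<open>col_scale z H\<close> when \<open>z $ i = 0\<close>.\<close>

definition col_polar :: "real ^ 'n \<Rightarrow> (real ^ 'k) ^ 'n \<Rightarrow> bool"
  where "col_polar z H \<longleftrightarrow> (\<forall>i. 0 \<le> z $ i) \<and> (\<forall>i. H $ i \<in> sphere 0 1)"

text \<open>Angular distance; meaningful for unit vectors only.\<close>

definition ang_dist :: "real ^ 'k \<Rightarrow> real ^ 'k \<Rightarrow> real"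
  where "ang_dist h h' = arccos (h \<bullet> h')"

end

theory Submission
  imports Defs
begin

text \<open>
  Since \<open>V\<close> lies in the range of \<open>\<A>\<^sup>*\<close>, the matrices \<open>Z0\<close> and \<open>Zhat = zhat.Hhat\<close> have the same
  inner product with \<open>V\<close>. By minimality this inner product is at least the norm of \<open>Zhat\<close>,
  whereas every nonzero column other than \<open>istar\<close> contributes strictly less to it than to the norm.
  Hence column \<open>istar\<close> of \<open>Zhat\<close> is nonzero and \<open>Hhat $ istar \<bullet> column istar V \<ge> 1\<close>. So
  \<open>Hhat $ istar\<close> is within angle \<open>\<alpha>\<close> of \<open>column istar V\<close>, and the triangle inequality on the
  sphere concludes.
\<close>

lemma abs_inner_unit_le:
  fixes u v :: "'a :: real_inner"
  assumes "norm u = 1" "norm v = 1"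
  shows "\<bar>u \<bullet> v\<bar> \<le> 1"
  using Cauchy_Schwarz_ineq2[of u v] assms by simp

lemma ang_dist_le_pi:
  assumes "norm u = 1" "norm v = 1"
  shows "ang_dist u v \<le> pi"
  using abs_inner_unit_le[OF assms] unfolding ang_dist_def by (intro arccos_ubound) auto

lemma cos_ang_dist:
  assumes "norm u = 1" "norm v = 1"
  shows "cos (ang_dist u v) = u \<bullet> v"
  using abs_inner_unit_le[OF assms] unfolding ang_dist_def by (intro cos_arccos) auto

lemma ang_dist_nonneg:
  assumes "norm u = 1" "norm v = 1"
  shows "0 \<le> ang_dist u v"
  using abs_inner_unit_le[OF assms] unfolding ang_dist_def by (intro arccos_lbound) auto

lemma ang_dist_commute: "ang_dist u v = ang_dist v u"
  by (simp add: ang_dist_def inner_commute)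

lemma norm_orthogonal_part:
  assumes "norm u = 1" "norm v = 1"
  shows "norm (u - (u \<bullet> v) *\<^sub>R v) = sin (ang_dist u v)"
proof -
  have uv: "u \<bullet> u = 1" "v \<bullet> v = 1"
    using assms by (simp_all add: dot_square_norm)
  have "(norm (u - (u \<bullet> v) *\<^sub>R v))\<^sup>2 = 1 - (u \<bullet> v)\<^sup>2"
    unfolding power2_norm_eq_inner unfolding power2_eq_square
    by (simp add: inner_diff_left inner_diff_right uv inner_commute[of v u])
  also have "\<dots> = (sin (ang_dist u v))\<^sup>2"
    using sin_squared_eq[of "ang_dist u v"] by (simp add: cos_ang_dist[OF assms])
  finally show ?thesis
    using sin_ge_zero[OF ang_dist_nonneg[OF assms] ang_dist_le_pi[OF assms]]
    by (simp add: power2_eq_iff_nonneg)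
qed

text \<open>Splitting \<open>u\<close> and \<open>w\<close> along \<open>v\<close> and orthogonally
  to it, Cauchy-Schwarz on the orthogonal parts bounds the cosine of the angle sum by
  \<open>u \<bullet> w\<close>. The cosine decreases only on [0, pi]; a larger angle sum makes the
  bound trivial.\<close>

lemma ang_dist_triangle:
  assumes "norm u = 1" "norm v = 1" "norm w = 1"
  shows "ang_dist u w \<le> ang_dist u v + ang_dist v w"
proof (cases "ang_dist u v + ang_dist v w \<le> pi")
  case True
  let ?u = "u - (u \<bullet> v) *\<^sub>R v" and ?w = "w - (w \<bullet> v) *\<^sub>R v"
  have vv: "v \<bullet> v = 1"
    using assms by (simp add: dot_square_norm)
  have "cos (ang_dist u v + ang_dist v w)
      = (u \<bullet> v) * (v \<bullet> w) - norm ?u * norm ?w"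
    using norm_orthogonal_part[OF assms(1,2)] norm_orthogonal_part[OF assms(3,2)]
    by (simp add: cos_add cos_ang_dist assms ang_dist_commute[of w])
  also have "\<dots> \<le> (u \<bullet> v) * (v \<bullet> w) + ?u \<bullet> ?w"
    using Cauchy_Schwarz_ineq2[of ?u ?w] by linarith
  also have "\<dots> = u \<bullet> w"
    by (simp add: inner_diff_left inner_diff_right vv inner_commute algebra_simps)
  also have "\<dots> = cos (ang_dist u w)"
    using assms by (simp add: cos_ang_dist)
  finally show ?thesis
    using True assms by (subst (asm) cos_mono_le_eq) (auto simp: ang_dist_nonneg ang_dist_le_pi)
next
  case False
  then show ?thesis
    using ang_dist_le_pi[OF assms(1,3)] by linarith
qed

lemma inner_eq_sum_columns:
  fixes X Y :: "real ^ 'n ^ 'k"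
  shows "X \<bullet> Y = (\<Sum>i\<in>UNIV. column i X \<bullet> column i Y)"
  unfolding inner_vec_def column_def by (subst sum.swap) simp

lemma column_col_scale: "column i (col_scale z H) = z $ i *\<^sub>R H $ i"
  by (simp add: col_scale_def column_def vec_eq_iff)

lemma norm12_col_scale:
  assumes "col_polar z H"
  shows "norm12 (col_scale z H) = (\<Sum>i\<in>UNIV. z $ i)"
  using assms by (simp add: norm12_def column_col_scale col_polar_def)

text \<open>The number 1 separates \<open>norm v * cos \<alpha>\<close> from
  \<open>h \<bullet> v\<close>; dividing by \<open>norm v\<close> compares two cosines of angles in
  [0, pi].\<close>

lemma ang_dist_normalized_le:
  assumes "norm h = 1" "h \<bullet> v \<ge> 1" "norm v * cos \<alpha> \<le> 1" "0 \<le> \<alpha>" "\<alpha> \<le> pi"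
  shows "ang_dist h (v /\<^sub>R norm v) \<le> \<alpha>"
proof -
  have "v \<noteq> 0"
    using assms(2) by auto
  then have n: "norm (v /\<^sub>R norm v) = 1" and pos: "norm v > 0"
    by auto
  have "norm v * cos \<alpha> \<le> h \<bullet> v"
    using assms by linarith
  then have "cos \<alpha> \<le> h \<bullet> (v /\<^sub>R norm v)"
    using pos by (simp add: field_simps)
  also have "\<dots> = cos (ang_dist h (v /\<^sub>R norm v))"
    using cos_ang_dist[OF assms(1) n] by simp
  finally show ?thesis
    using assms n by (subst (asm) cos_mono_le_eq) (auto simp: ang_dist_nonneg ang_dist_le_pi)
qed

theorem theorem3p1:
  fixes \<A> :: "real ^ 'n ^ 'k \<Rightarrow> real ^ 'm"
    and Z0 V :: "real ^ 'n ^ 'k"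
    and z0 zhat :: "real ^ 'n"
    and H0 Hhat :: "(real ^ 'k) ^ 'n"
    and S :: "'n set"
    and istar :: 'n
    and \<alpha> :: real
    and p :: "real ^ 'm"
  assumes "linear \<A>"
    and "col_polar z0 H0" and "Z0 = col_scale z0 H0"
    and "S = col_supp Z0"
    and "istar \<in> S"
    and "\<alpha> > 0"
    and "V = adjoint \<A> p"
    and "(\<Sum>i\<in>S. (H0 $ i \<bullet> column i V) * z0 $ i) \<ge> norm1 z0"
    and "\<And>i. i \<noteq> istar \<Longrightarrow> norm (column i V) < 1"
    and "ang_dist (H0 $ istar) (column istar V /\<^sub>R norm (column istar V)) \<le> \<alpha>"
    and "norm (column istar V) * cos \<alpha> \<le> 1"
    and "col_polar zhat Hhat"
    and "is_arg_min norm12 (\<lambda>Z. \<A> Z = \<A> Z0) (col_scale zhat Hhat)"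
  shows "ang_dist (Hhat $ istar) (H0 $ istar) \<le> 2 * \<alpha>"
proof -
  have z0: "z0 $ i \<ge> 0" and zh: "zhat $ i \<ge> 0"
    and H0: "norm (H0 $ i) = 1" and Hh: "norm (Hhat $ i) = 1" for i
    using assms(2,12) by (auto simp: col_polar_def)
  define Zh where "Zh = col_scale zhat Hhat"
  have feas: "\<A> Zh = \<A> Z0" and "norm12 Zh \<le> norm12 Z0"
    using assms(13) unfolding is_arg_min_def Zh_def by (auto simp: not_less)
  then have min: "(\<Sum>i\<in>UNIV. zhat $ i) \<le> norm1 z0"
    using assms(2,3,12) z0 by (simp add: Zh_def norm12_col_scale norm1_def)
  have V: "X \<bullet> V = \<A> X \<bullet> p" for X
    using adjoint_works[OF assms(1), of X p] assms(7) by simp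
  \<comment> \<open>Columns of \<open>Z0\<close> outside \<open>S\<close> vanish, so the sum extends
    to all indices.\<close>
  have "(\<Sum>i\<in>S. (H0 $ i \<bullet> column i V) * z0 $ i) = Z0 \<bullet> V"
    unfolding inner_eq_sum_columns assms(3) column_col_scale
    by (rule sum.mono_neutral_cong_left)
      (auto simp: assms(3,4) col_supp_def column_col_scale)
  then have Z0V: "norm1 z0 \<le> Z0 \<bullet> V"
    using assms(8) by simp
  have "z0 $ istar \<noteq> 0"
    using assms(3-5) by (auto simp: col_supp_def column_col_scale)
  then have "norm1 z0 > 0"
    unfolding norm1_def by (intro sum_pos2[of _ istar]) auto
  define c where "c i = Hhat $ i \<bullet> column i V" for i
  have ZhV: "Zh \<bullet> V = (\<Sum>i\<in>UNIV. zhat $ i * c i)"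
    by (simp add: inner_eq_sum_columns Zh_def column_col_scale c_def)
  have eq: "Zh \<bullet> V = Z0 \<bullet> V"
    using V feas by simp
  have c_less: "c i < 1" if "i \<noteq> istar" for i
  proof -
    have "c i \<le> norm (column i V)"
      using norm_cauchy_schwarz[of "Hhat $ i" "column i V"] Hh by (simp add: c_def)
    then show ?thesis
      using assms(9)[OF that] by linarith
  qed
  have c_istar: "c istar \<ge> 1"
  proof (rule ccontr)
    assume "\<not> c istar \<ge> 1"
    then have c1: "c i < 1" for i
      using c_less[of i] by (cases "i = istar") auto
    \<comment> \<open>A strict inequality between the sums needs a positive weight
      \<open>zhat $ j\<close>. One exists because \<open>Zh\<close> cannot vanish: its inner product
      with \<open>V\<close> is at least \<open>norm1 z0 > 0\<close>.\<close>
    have "Zh \<bullet> V \<noteq> 0"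
      using eq Z0V \<open>norm1 z0 > 0\<close> by linarith
    then obtain j where j: "zhat $ j \<noteq> 0"
      unfolding ZhV by (fastforce elim: sum.not_neutral_contains_not_neutral)
    have "(\<Sum>i\<in>UNIV. zhat $ i * c i) < (\<Sum>i\<in>UNIV. zhat $ i)"
    proof (rule sum_strict_mono_ex1)
      show "\<forall>i\<in>UNIV. zhat $ i * c i \<le> zhat $ i"
        using c1 zh by (simp add: less_imp_le mult_left_le)
      show "\<exists>i\<in>UNIV. zhat $ i * c i < zhat $ i"
        using mult_strict_left_mono[OF c1[of j], of "zhat $ j"] zh[of j] j
        by (intro bexI[of _ j]) auto
    qed simp
    then show False
      using ZhV eq Z0V min by linarith
  qed
  show ?thesis
  \<comment> \<open>There is no upper bound on \<open>\<alpha>\<close>, while comparing cosines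
    requires \<open>\<alpha> \<le> pi\<close>. Beyond that, no angular distance can exceed
    \<open>2 * \<alpha>\<close>.\<close>
  proof (cases "\<alpha> \<le> pi")
    case True
    let ?v = "column istar V /\<^sub>R norm (column istar V)"
    \<comment> \<open>For a zero column, division by zero would make \<open>?v\<close> the zero
      vector, to which the triangle inequality does not apply.\<close>
    have "column istar V \<noteq> 0"
      using c_istar by (auto simp: c_def)
    then have "norm ?v = 1"
      by simp
    moreover have "ang_dist (Hhat $ istar) ?v \<le> \<alpha>"
      using c_istar assms(6,11) True Hh by (intro ang_dist_normalized_le) (auto simp: c_def)
    ultimately show ?thesis
      using ang_dist_triangle[OF Hh _ H0, of ?v istar istar] assms(10)
      by (simp add: ang_dist_commute[of ?v])
  next
    case False
    then show ?thesis
      using ang_dist_le_pi[OF Hh H0, of istar istar] pi_gt_zero by linarith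
  qed
qed

end
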